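(* Let $q$ be a prime power and let $n$ be a positive integer. The following identity holds in $\mathbb{F}_{q^n}[X,Y]$: $$X^{q^n-1}-1+\prod_{z\in\mathbb{F}_{q^n}^*}(1+zX-z^qY)=-Y\cdot\biggl(\frac{X^{q^n-1}-Y^{q^n-1}}{X^{\frac{q^n-1}{q-1}}-Y^{\frac{q^n-1}{q-1}}}\biggr)\cdot\Bigl(Y^{\frac{q^n-q}{q-1}}+\sum_{i=1}^{n-1}X^{1+\frac{q^n-q^{i+1}}{q-1}}Y^{\frac{q^i-q}{q-1}}\Bigr).$$
   Context: The quotient in parentheses is a polynomial in $X,Y$, since $\frac{q^n-1}{q-1}$ divides $q^n-1$. An empty sum (when $n=1$) is $0$. *)

theory Defs
  imports
    "HOL-Computational_Algebra.Polynomial"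
    "HOL-Number_Theory.Prime_Powers"
begin

(* The ring F[X,Y] is rendered as F[X][Y], i.e. the type 'a poly poly: the outer polynomial
   variable is Y, and the coefficients are polynomials in X. *)

definition X :: "'a :: comm_ring_1 poly poly" where
  "X = [:[:0, 1:]:]"

definition Y :: "'a :: comm_ring_1 poly poly" where
  "Y = [:0, 1:]"

definition Const :: "'a :: comm_ring_1 \<Rightarrow> 'a poly poly" where
  "Const z = [:[:z:]:]"

(* On 'a poly poly, "div" is the exact division of an integral domain, which is meaningful only
   if the divisor is nonzero and divides the dividend. The next two facts show that this holds
   for X^m - Y^m and X^k - Y^k whenever k divides m and k > 0. *)

lemma X_power_minus_Y_power_dvd:
  assumes "k dvd m"
  shows "X ^ k - Y ^ k dvd (X ^ m - Y ^ m :: 'a :: comm_ring_1 poly poly)"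
proof -
  from assms obtain j where "m = k * j" ..
  then have "X ^ m - Y ^ m = (X ^ k) ^ j - (Y ^ k :: 'a poly poly) ^ j"
    by (simp add: power_mult)
  then show ?thesis
    by (metis dvd_triv_left power_diff_sumr2)
qed

lemma X_power_minus_Y_power_nonzero:
  assumes "k > 0"
  shows "X ^ k - Y ^ k \<noteq> (0 :: 'a :: field poly poly)"
proof
  assume "X ^ k - Y ^ k = (0 :: 'a poly poly)"
  then have "poly (X ^ k - Y ^ k) 0 = (0 :: 'a poly)"
    by simp
  then show False
    using assms by (simp add: X_def Y_def poly_power zero_power)
qed

end

theory Submission
  imports Defs
begin

text \<open>
  Write \<open>N = 1 + q + \<dots> + q ^ (n - 1)\<close>, let \<open>Q\<close> be the quotient of
  \<open>X ^ (q ^ n - 1) - Y ^ (q ^ n - 1)\<close> by \<open>X ^ N - Y ^ N\<close>, and put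
  \<open>C(T) = (\<Sum>i<n. X ^ (1 + q ^ (i + 1) + \<dots> + q ^ (n - 1)) * Y ^ (1 + \<dots> + q ^ (i - 1)) * T ^ (q ^ i))\<close>.
  The polynomial \<open>T ^ (q ^ n) - Y ^ (q ^ n - 1) * T - Q * C(T)\<close> is monic of degree \<open>q ^ n\<close> in \<open>T\<close>.
  It vanishes at the \<open>q ^ n\<close> distinct points \<open>z ^ q * Y - z * X\<close>, because there \<open>C(T)\<close> telescopes
  to \<open>- z * X * (X ^ N - Y ^ N)\<close>. Hence it equals \<open>\<Prod>z. (T + z * X - z ^ q * Y)\<close>, and \<open>T = 1\<close>
  gives the claim.
\<close>

text \<open>Turns the quotients in the theorem's exponents into differences of partial geometric
  sums, which add up well.\<close>

lemma geometric_sum_diff_nat: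
  fixes q :: nat
  assumes "q > 1" "j \<le> i"
  shows "(q ^ i - q ^ j) div (q - 1) = (\<Sum>k<i. q ^ k) - (\<Sum>k<j. q ^ k)"
proof -
  have *: "q ^ m = (q - 1) * (\<Sum>k<m. q ^ k) + 1" for m
  proof -
    have "int (q ^ m) - 1 = int ((q - 1) * (\<Sum>k<m. q ^ k))"
      using power_diff_1_eq[of "int q" m] assms by (simp add: of_nat_diff)
    then show ?thesis by linarith
  qed
  have "q ^ i - q ^ j = (q - 1) * ((\<Sum>k<i. q ^ k) - (\<Sum>k<j. q ^ k))"
    by (subst (1 2) *) (simp add: diff_mult_distrib2)
  then show ?thesis using assms by simp
qed

lemma finite_field_power_card:
  fixes z :: "'a :: {field, finite}"
  shows "z ^ card (UNIV :: 'a set) = z"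
proof (cases "z = 0")
  case False
  let ?U = "UNIV - {0 :: 'a}"
  \<comment> \<open>Multiplication by a nonzero \<open>z\<close> permutes the nonzero elements;
    their product is nonzero and cancels.\<close>
  have "prod id ?U = (\<Prod>w\<in>?U. z * w)"
    by (rule prod.reindex_bij_witness[of _ "\<lambda>w. z * w" "\<lambda>w. w / z"]) (use False in auto)
  also have "\<dots> = z ^ card ?U * prod id ?U"
    by (simp add: prod.distrib)
  finally have "z ^ card ?U = 1" by simp
  moreover have "card (UNIV :: 'a set) = Suc (card ?U)"
    using card_Suc_Diff1[of "UNIV :: 'a set" 0] by simp
  ultimately show ?thesis by (metis mult.right_neutral power_Suc)
qed (simp add: card_gt_0_iff)

lemma CHAR_finite_field:
  assumes "prime p" "card (UNIV :: 'a :: {field, finite} set) = p ^ m"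
  shows "CHAR('a) = p"
proof -
  have "prime CHAR('a)"
    by (simp add: finite_imp_CHAR_pos prime_CHAR_semidom)
  moreover have "CHAR('a) dvd p ^ m"
  proof -
    \<comment> \<open>Translation by 1 permutes the field, so its cardinality is zero in it.\<close>
    have "(\<Sum>z\<in>UNIV. z + 1 :: 'a) = (\<Sum>z\<in>UNIV. z)"
      by (rule sum.reindex_bij_witness[of _ "\<lambda>z. z - 1" "\<lambda>z. z + 1"]) auto
    then have "of_nat (p ^ m) = (0 :: 'a)"
      by (simp add: sum.distrib assms(2))
    then show ?thesis
      by (simp only: of_nat_eq_0_iff_char_dvd)
  qed
  ultimately show ?thesis
    using assms(1) by (meson prime_dvd_power primes_dvd_imp_eq)
qed

lemma freshmans_dream_diff:
  fixes u v :: "'a :: comm_ring_1"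
  assumes "prime CHAR('a)"
  shows "(u - v) ^ (CHAR('a) ^ m) = u ^ (CHAR('a) ^ m) - v ^ (CHAR('a) ^ m)"
  \<comment> \<open>Expanding \<open>(u - v) + v\<close> avoids the sign of a power of -1.\<close>
  using freshmans_dream'[OF assms refl, of "u - v" v m] by (simp add: algebra_simps)

text \<open>Frobenius splits the last factor in two: one part raises the exponent of
  \<open>y\<close> from \<open>G i\<close> to \<open>G (Suc i)\<close>, the other raises that of
  \<open>x\<close> by \<open>q ^ i\<close>. The summand thus becomes a difference of consecutive
  values of one function.\<close>

lemma sum_frobenius_telescope:
  fixes x y z :: "'a :: comm_ring_1" and q n :: nat
  assumes frob: "\<And>i u v. (u - v :: 'a) ^ (q ^ i) = u ^ (q ^ i) - v ^ (q ^ i)"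
  defines "G \<equiv> \<lambda>m. \<Sum>k<m. q ^ k"
  shows "(\<Sum>i<n. x ^ (1 + (G n - G (Suc i))) * y ^ G i * (z ^ q * y - z * x) ^ (q ^ i)) =
    z ^ (q ^ n) * x * y ^ G n - z * x ^ (1 + G n)"
proof -
  define f where "f i = x ^ (1 + (G n - G i)) * y ^ G i * z ^ (q ^ i)" for i
  have "x ^ (1 + (G n - G (Suc i))) * y ^ G i * (z ^ q * y - z * x) ^ (q ^ i) = f (Suc i) - f i"
    if "i < n" for i
  proof -
    have "G (Suc i) \<le> G n"
      unfolding G_def using that by (intro sum_mono2) auto
    moreover have G_Suc: "G (Suc i) = G i + q ^ i"
      by (simp add: G_def)
    ultimately have "G n - G i = (G n - G (Suc i)) + q ^ i"
      by simp
    then show ?thesis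
      unfolding f_def frob
      by (simp add: G_Suc power_add power_mult_distrib algebra_simps flip: power_mult)
  qed
  then have "(\<Sum>i<n. x ^ (1 + (G n - G (Suc i))) * y ^ G i * (z ^ q * y - z * x) ^ (q ^ i)) = f n - f 0"
    by (simp add: sum_lessThan_telescope)
  then show ?thesis by (simp add: f_def G_def algebra_simps)
qed

lemma Const_power: "Const (z ^ k) = Const z ^ k"
  proof (induction k)
  case (Suc k)
  have "Const (z * z ^ k) = Const z * Const (z ^ k)" by (simp add: Const_def)
  with Suc show ?case by simp
qed (simp add: Const_def one_pCons)

text \<open>The coefficient of \<open>X\<close> alone recovers \<open>z\<close>, so \<open>f\<close>
  may be arbitrary.\<close>

lemma inj_Const_Y_minus_Const_X:
  "inj (\<lambda>z :: 'a :: comm_ring_1. Const (f z) * Y - Const z * X)"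
proof -
  have "Const w * Y - Const z * X = [:[:0, - z:], [:w:]:]" for w z :: 'a
    by (simp add: Const_def X_def Y_def)
  then show ?thesis by (auto intro: injI)
qed

text \<open>\<open>Q\<close> enters only through its defining equation, which keeps
  \<open>div\<close> out of the argument.\<close>

lemma prod_linear_forms:
  fixes q n :: nat and t :: "'a :: {field, finite} poly poly"
  assumes q: "q > 1" and n: "n > 0" and card: "card (UNIV :: 'a set) = q ^ n"
    and frob: "\<And>i u v. (u - v :: 'a poly poly) ^ (q ^ i) = u ^ (q ^ i) - v ^ (q ^ i)"
  defines "G \<equiv> \<lambda>m. \<Sum>k<m. q ^ k"
  assumes Q: "Q * (X ^ G n - Y ^ G n) = X ^ (q ^ n - 1) - (Y ^ (q ^ n - 1) :: 'a poly poly)"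
  shows "(\<Prod>z\<in>UNIV. t + Const z * X - Const (z ^ q) * Y) =
    t ^ (q ^ n) - Y ^ (q ^ n - 1) * t -
      Q * (\<Sum>i<n. X ^ (1 + (G n - G (Suc i))) * Y ^ G i * t ^ (q ^ i))"
proof -
  define a :: "'a \<Rightarrow> 'a poly poly" where "a z = Const (z ^ q) * Y - Const z * X" for z
  define c :: "nat \<Rightarrow> 'a poly poly" where "c i = X ^ (1 + (G n - G (Suc i))) * Y ^ G i" for i
  \<comment> \<open>\<open>P\<close> and \<open>M\<close> are polynomials in a third variable T over
    F[X,Y].\<close>
  define P where "P = (\<Prod>z\<in>UNIV. [:- a z, 1:])"
  define S where "S = (\<Sum>i<n. monom (c i) (q ^ i))"
  define M where "M = monom 1 (q ^ n) - monom (Y ^ (q ^ n - 1)) 1 - smult Q S"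
  have poly_M: "poly M u = u ^ (q ^ n) - Y ^ (q ^ n - 1) * u - Q * (\<Sum>i<n. c i * u ^ (q ^ i))" for u
    by (simp add: M_def S_def poly_monom poly_sum)
  have qn: "1 < q ^ n" using q n by (intro one_less_power)
  have "degree S < q ^ n"
  proof -
    have "degree (monom (c i) (q ^ i)) \<le> q ^ n - 1" if "i < n" for i
    proof -
      have "q ^ i < q ^ n" using q that by (simp add: power_strict_increasing)
      then show ?thesis using degree_monom_le[of "c i" "q ^ i"] by linarith
    qed
    then have "degree S \<le> q ^ n - 1"
      unfolding S_def by (intro degree_sum_le) auto
    with qn show ?thesis by linarith
  qed
  then have deg_smult: "degree (smult Q S) < q ^ n"
    using degree_smult_le[of Q S] by linarith
  have coeff_M: "coeff M (q ^ n) = 1"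
    using coeff_eq_0[OF deg_smult] qn by (simp add: M_def)
  have deg_M: "degree M \<le> q ^ n"
    unfolding M_def using deg_smult qn degree_monom_le[of "Y ^ (q ^ n - 1) :: 'a poly poly" 1]
    by (intro degree_diff_le) (auto simp: degree_monom_eq)
  have deg_P: "degree P = q ^ n"
    unfolding P_def using card by (subst degree_prod_eq_sum_degree) auto
  have coeff_P: "coeff P (q ^ n) = 1"
    using lead_coeff_prod[of "\<lambda>z. [:- a z, 1:]" UNIV] deg_P by (simp add: P_def)
  have "P = M"
  \<comment> \<open>The leading terms cancel in \<open>P - M\<close>, so agreement at
    \<open>q ^ n\<close> points suffices.\<close>
  proof (rule poly_eqI_degree_lead_coeff[where A = "range a" and n = "q ^ n"])
    have "inj a"
      unfolding a_def by (rule inj_Const_Y_minus_Const_X)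
    then show "card (range a) \<ge> q ^ n"
      using card by (simp add: card_image)
    show "poly P u = poly M u" if "u \<in> range a" for u
    proof -
      obtain z where u: "u = a z" using \<open>u \<in> range a\<close> by auto
      define w where "w = Const z"
      have w: "w ^ (q ^ n) = w"
        using finite_field_power_card[of z] card by (simp add: w_def flip: Const_power)
      have a: "a z = w ^ q * Y - w * X" by (simp add: a_def w_def Const_power)
      have "(w ^ q) ^ (q ^ n) = w ^ q"
        by (metis w mult.commute power_mult)
      then have 1: "u ^ (q ^ n) = w ^ q * Y ^ (q ^ n) - w * X ^ (q ^ n)"
        unfolding u a frob by (simp add: power_mult_distrib w)
      have "(\<Sum>i<n. c i * u ^ (q ^ i)) = - (w * X) * (X ^ G n - Y ^ G n)"
        unfolding c_def u a G_def sum_frobenius_telescope[OF frob] w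
        by (simp add: algebra_simps)
      then have "Q * (\<Sum>i<n. c i * u ^ (q ^ i)) = - (w * X) * (Q * (X ^ G n - Y ^ G n))"
        by (simp only: mult.left_commute)
      then have 2: "Q * (\<Sum>i<n. c i * u ^ (q ^ i)) = - (w * X) * (X ^ (q ^ n - 1) - Y ^ (q ^ n - 1))"
        unfolding Q .
      \<comment> \<open>With one factor split off the powers of \<open>X\<close> and
        \<open>Y\<close>, the terms of \<open>poly M u\<close> cancel in pairs.\<close>
      have 3: "v ^ (q ^ n) = v * v ^ (q ^ n - 1)" for v :: "'a poly poly"
        using q by (subst power_eq_if) auto
      then have "poly M u = 0"
        unfolding poly_M 1 2 3[of X] 3[of Y] unfolding u a by (simp add: algebra_simps)
      moreover have "poly P u = 0"
        by (auto simp: P_def poly_prod u)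
      ultimately show ?thesis by simp
    qed
  qed (use coeff_M coeff_P deg_M deg_P in auto)
  then have "poly P t = poly M t" by simp
  then show ?thesis
    unfolding poly_M by (simp add: P_def poly_prod a_def c_def algebra_simps)
qed

theorem theorem8p1:
  fixes q n :: nat
  assumes "primepow q"
    and "n > 0"
    and "card (UNIV :: 'a :: {field, finite} set) = q ^ n"
  shows "X ^ (q ^ n - 1) - 1 + (\<Prod>z\<in>UNIV - {0 :: 'a}. 1 + Const z * X - Const (z ^ q) * Y) =
    - Y * ((X ^ (q ^ n - 1) - Y ^ (q ^ n - 1)) div
           (X ^ ((q ^ n - 1) div (q - 1)) - Y ^ ((q ^ n - 1) div (q - 1)))) *
      (Y ^ ((q ^ n - q) div (q - 1)) +
       (\<Sum>i = 1..n - 1. X ^ (1 + (q ^ n - q ^ (i + 1)) div (q - 1)) * Y ^ ((q ^ i - q) div (q - 1))))"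
proof -
  from assms(1) obtain p k where p: "prime p" "q = p ^ k"
    by (auto simp: primepow_def)
  have q: "q > 1" using primepow_gt_Suc_0[OF assms(1)] by simp
  \<comment> \<open>The field has \<open>p ^ (k * n)\<close> elements, and passing to polynomials
    keeps the characteristic.\<close>
  have char: "CHAR('a poly poly) = p"
    using CHAR_finite_field[of p "k * n"] p assms(3) by (simp add: power_mult)
  have frob: "(u - v :: 'a poly poly) ^ (q ^ i) = u ^ (q ^ i) - v ^ (q ^ i)" for i u v
    using freshmans_dream_diff[of u v "k * i"] p char by (simp add: power_mult)
  define G where "G m = (\<Sum>k<m. q ^ k)" for m
  have G_0: "G 0 = 0" and G_1: "G (Suc 0) = 1" by (simp_all add: G_def)
  have G: "(q ^ i - q ^ j) div (q - 1) = G i - G j" if "j \<le> i" for i j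
    unfolding G_def using q that by (rule geometric_sum_diff_nat)
  have N: "(q ^ n - 1) div (q - 1) = G n" using G[of 0 n] by (simp add: G_0)
  have G_pos: "G i = Suc (G i - 1)" if "i > 0" for i
  proof -
    have "G 1 \<le> G i" unfolding G_def using that by (intro sum_mono2) auto
    then show ?thesis by (simp add: G_1)
  qed
  define x y :: "'a poly poly" where "x = X" and "y = Y"
  have y_pow: "y ^ G i = y * y ^ (G i - 1)" if "i > 0" for i
    using G_pos[OF that] by (metis power_Suc)
  define Q where "Q = (x ^ (q ^ n - 1) - y ^ (q ^ n - 1)) div (x ^ G n - y ^ G n)"
  define R where "R = (\<Sum>i = 1..n - 1. x ^ (1 + (G n - G (Suc i))) * y ^ (G i - 1))"
  have "q - 1 dvd q ^ n - 1"
    using power_diff_1_eq[of "int q" n] q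
    by (metis dvd_def int_dvd_int_iff of_nat_diff of_nat_1 of_nat_power less_imp_le one_le_power)
  then have "(q ^ n - 1) = G n * (q - 1)" using N by (metis dvd_div_mult_self)
  then have Q: "Q * (x ^ G n - y ^ G n) = x ^ (q ^ n - 1) - y ^ (q ^ n - 1)"
    unfolding Q_def x_def y_def by (intro dvd_div_mult_self X_power_minus_Y_power_dvd) simp
  \<comment> \<open>The term \<open>i = 0\<close> is \<open>x ^ G n\<close>, since
    \<open>G 0 = 0\<close> and \<open>G 1 = 1\<close>; every other term contains a factor
    \<open>y\<close>.\<close>
  have "(\<Sum>i<n. x ^ (1 + (G n - G (Suc i))) * y ^ G i) =
      x ^ G n + (\<Sum>i = 1..n - 1. x ^ (1 + (G n - G (Suc i))) * y ^ G i)"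
  proof -
    have "{..<n} = insert 0 {1..n - 1}" using assms(2) by auto
    moreover have "1 + (G n - G (Suc 0)) = G n" using G_pos[OF assms(2)] G_1 by linarith
    ultimately show ?thesis by (simp add: G_0 flip: power_Suc)
  qed
  also have "(\<Sum>i = 1..n - 1. x ^ (1 + (G n - G (Suc i))) * y ^ G i) = y * R"
    unfolding R_def sum_distrib_left
  proof (rule sum.cong)
    fix i assume "i \<in> {1..n - 1}"
    then have "y ^ G i = y * y ^ (G i - 1)" by (intro y_pow) simp
    then show "x ^ (1 + (G n - G (Suc i))) * y ^ G i = y * (x ^ (1 + (G n - G (Suc i))) * y ^ (G i - 1))"
      by (simp only: mult.left_commute)
  qed simp
  finally have sum: "(\<Sum>i<n. x ^ (1 + (G n - G (Suc i))) * y ^ G i) = x ^ G n + y * R" .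
  \<comment> \<open>The factor for \<open>z = 0\<close> is 1, because \<open>q > 0\<close>.\<close>
  have "(\<Prod>z\<in>UNIV - {0 :: 'a}. 1 + Const z * x - Const (z ^ q) * y) =
      (\<Prod>z\<in>UNIV. 1 + Const z * x - Const (z ^ q) * y)"
    using q by (intro prod.mono_neutral_left) (auto simp: Const_def)
  also have "\<dots> = 1 - y ^ (q ^ n - 1) - Q * (x ^ G n + y * R)"
    using prod_linear_forms[OF q assms(2,3) frob, of Q 1] Q sum
    by (simp add: G_def x_def y_def)
  finally have "x ^ (q ^ n - 1) - 1 + (\<Prod>z\<in>UNIV - {0 :: 'a}. 1 + Const z * x - Const (z ^ q) * y) =
      Q * (x ^ G n - y ^ G n) - Q * (x ^ G n + y * R)"
    unfolding Q by simp
  \<comment> \<open>The two copies of \<open>Q * x ^ G n\<close> cancel, and what remains is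
    divisible by \<open>y\<close>.\<close>
  also have "\<dots> = - y * Q * (y ^ (G n - 1) + R)"
    by (subst y_pow[OF assms(2)]) (simp add: algebra_simps)
  also have "R = (\<Sum>i = 1..n - 1. x ^ (1 + (q ^ n - q ^ (i + 1)) div (q - 1)) * y ^ ((q ^ i - q) div (q - 1)))"
    unfolding R_def
  proof (rule sum.cong)
    fix i assume "i \<in> {1..n - 1}"
    then have "Suc i \<le> n" "1 \<le> i" by auto
    then show "x ^ (1 + (G n - G (Suc i))) * y ^ (G i - 1) =
        x ^ (1 + (q ^ n - q ^ (i + 1)) div (q - 1)) * y ^ ((q ^ i - q) div (q - 1))"
      using G[of "Suc i" n] G[of 1 i] by (simp add: G_1)
  qed simp
  also have "G n - 1 = (q ^ n - q) div (q - 1)"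
    using G[of 1 n] assms(2) by (simp add: G_1)
  finally show ?thesis
    unfolding Q_def x_def y_def N .
qed

end
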